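(* Let $n\in\mathbb N$, let $U,V\subset\mathbb R^n$ be domains, $(s,t)\subset\mathbb R$ an open interval, $\underline a=\sum_{i=1}^n a_ie_i\in C^1(U,V)$ a diffeomorphism with real-valued components, and $a:(s,t)\times U\to(s,t)\times V$, $a(x)=x_0+\underline a(\underline x)$. Let $f\in C^1((s,t)\times U,\mathbb R_{0,n})$ be such that $f\circ a^{-1}\in\mathcal{SM}((s,t)\times V)$, and suppose $\mathbb B^{n+1}(0,1)\subset(s,t)\times V$. Then $\mathcal H_a(f)=0$ on $(s,t)\times U$, and there exists a sequence $(c_k)_{k\ge0}$ of elements of $\mathbb R_{0,n}$ such that $$f(x)=\sum_{k=0}^\infty (a(x))^k c_k,\qquad\forall x\in a^{-1}(\mathbb B^{n+1}(0,1)).$$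
   Context: $\mathbb R_{0,n}$ is the real Clifford algebra generated by $e_1,\dots,e_n$ with $e_ie_j+e_je_i=-2\delta_{ij}$. A point of $\mathbb R^{n+1}$ is identified with the paravector $x=x_0+\underline x\in\mathbb R_{0,n}$, $\underline x=\sum_{j=1}^n x_je_j$; powers of $a(x)$ are taken in $\mathbb R_{0,n}$. $\mathbb B^{n+1}(0,1)$ is the open unit ball of $\mathbb R^{n+1}$. $\mathbb S=\{\underline x:\ x_1^2+\dots+x_n^2=1\}$; for $I\in\mathbb S$, $\mathbb C_I=\mathbb R+I\mathbb R\subset\mathbb R^{n+1}$. "Diffeomorphism" means a $C^1$ bijection with $C^1$ inverse; $a^{-1}(y)=y_0+\sum_j(a^{-1})_j(\underline y)e_j$, with $(a^{-1})_j$ the $j$-th component of $(\underline a)^{-1}$. Operator: $$\mathcal H_a(f)(x)=\underline a(\underline x)\frac{\partial f}{\partial x_0}(x)-\sum_{i=1}^n\Big(\sum_{j=1}^n a_j(\underline x)\Big(\frac{\partial(a^{-1})_i}{\partial y_j}\circ a\Big)(x)\Big)\frac{\partial f}{\partial x_i}(x).$$ For $W\subset\mathbb R^{n+1}$ open, $\mathcal{SM}(W)$ is the set of real differentiable $h:W\to\mathbb R_{0,n}$ with $\big(\frac{\partial}{\partial u}+I\frac{\partial}{\partial v}\big)h|_{W\cap\mathbb C_I}(u+Iv)=0$ on $W\cap\mathbb C_I$ for every $I\in\mathbb S$. *)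

theory Defs
  imports "HOL-Analysis.Analysis"
begin

section \<open>The real Clifford algebra with negative definite form\<close>

text \<open>
  The index type \<open>'n\<close> of the generators is an arbitrary nonempty finite linearly ordered type, so
  \<open>n = CARD('n)\<close> ranges over all positive integers. An element is given by its coordinates with
  respect to the \<open>2 ^ n\<close> basis blades \<open>e\<^sub>A = e\<^sub>i\<^sub>1 \<dots> e\<^sub>i\<^sub>k\<close>, where \<open>A = {i\<^sub>1 < \<dots> < i\<^sub>k}\<close>. A new type
  is needed since \<open>real ^ 'm\<close> already carries the componentwise product.
\<close>

typedef ('n::"{finite,linorder}") clifford = "UNIV :: (real ^ ('n set)) set"
  morphisms coords Clifford
  by simp

setup_lifting type_definition_clifford

instantiation clifford :: ("{finite,linorder}") real_vector
begin

lift_definition zero_clifford :: "'a clifford" is 0 .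
lift_definition plus_clifford :: "'a clifford \<Rightarrow> 'a clifford \<Rightarrow> 'a clifford" is "(+)" .
lift_definition minus_clifford :: "'a clifford \<Rightarrow> 'a clifford \<Rightarrow> 'a clifford" is "(-)" .
lift_definition uminus_clifford :: "'a clifford \<Rightarrow> 'a clifford" is "uminus" .
lift_definition scaleR_clifford :: "real \<Rightarrow> 'a clifford \<Rightarrow> 'a clifford" is "(*\<^sub>R)" .

instance
  by standard (transfer; simp add: algebra_simps)+

end

lemma linear_coords: "linear coords"
  by (rule linearI; transfer; simp)

lift_definition blade :: "'n set \<Rightarrow> 'n::{finite,linorder} clifford" is "\<lambda>A. axis A 1" .

lemma coords_blade: "coords (blade A) $ B = (if B = A then 1 else 0)"
  by transfer (simp add: axis_def)

lemma coords_simps [simp]: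
  "coords 0 = 0" "coords (x + y) = coords x + coords y" "coords (x - y) = coords x - coords y"
  "coords (- x) = - coords x" "coords (r *\<^sub>R x) = r *\<^sub>R coords x"
  by (transfer; simp)+

lemma coords_sum [simp]: "coords (\<Sum>i\<in>S. g i) = (\<Sum>i\<in>S. coords (g i))"
  by (rule linear_sum[OF linear_coords])

lemma clifford_eq_iff: "x = y \<longleftrightarrow> (\<forall>A. coords x $ A = coords y $ A)"
  by transfer (simp add: vec_eq_iff)

lemma blade_expansion: "x = (\<Sum>A\<in>UNIV. (coords x $ A) *\<^sub>R blade A)"
  by (simp add: clifford_eq_iff coords_blade if_distrib cong: if_cong)

text \<open>
  \<open>e\<^sub>A e\<^sub>B = \<plusminus> e\<^sub>C\<close> with \<open>C\<close> the symmetric difference of \<open>A\<close> and \<open>B\<close>. Sorting the concatenated product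
  gives a factor \<open>-1\<close> for each pair \<open>i \<in> A\<close>, \<open>j \<in> B\<close> with \<open>j < i\<close> (anticommutation), and cancelling
  gives a factor \<open>-1\<close> for each \<open>i = j\<close> (because \<open>e\<^sub>i\<^sup>2 = -1\<close>).
\<close>

definition blade_sign :: "'n::{finite,linorder} set \<Rightarrow> 'n set \<Rightarrow> real" where
  "blade_sign A B = (-1) ^ card {(i, j). i \<in> A \<and> j \<in> B \<and> j \<le> i}"

lemma blade_sign_prod:
  "blade_sign A B = (\<Prod>i\<in>UNIV. \<Prod>j\<in>UNIV. if i \<in> A \<and> j \<in> B \<and> j \<le> i then -1 else 1)"
proof -
  have "(\<Prod>i\<in>UNIV. \<Prod>j\<in>UNIV. if i \<in> A \<and> j \<in> B \<and> j \<le> i then -1 else (1::real))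
      = (\<Prod>p\<in>UNIV. if p \<in> {(i, j). i \<in> A \<and> j \<in> B \<and> j \<le> i} then -1 else 1)"
    by (simp add: prod.cartesian_product case_prod_unfold)
  also have "\<dots> = (\<Prod>p\<in>{(i, j). i \<in> A \<and> j \<in> B \<and> j \<le> i}. -1)"
    by (subst prod.inter_restrict[symmetric]) simp_all
  finally show ?thesis
    by (simp add: blade_sign_def)
qed

lemma blade_sign_sym_diff_left:
  "blade_sign (sym_diff A B) C = blade_sign A C * blade_sign B C"
  unfolding blade_sign_prod prod.distrib[symmetric]
  by (intro prod.cong refl) auto

lemma blade_sign_sym_diff_right:
  "blade_sign A (sym_diff B C) = blade_sign A B * blade_sign A C"
  unfolding blade_sign_prod prod.distrib[symmetric]
  by (intro prod.cong refl) auto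

lemma blade_sign_empty [simp]: "blade_sign {} A = 1" "blade_sign A {} = 1"
  by (simp_all add: blade_sign_def)

lemma sym_diff_assoc: "sym_diff (sym_diff A B) C = sym_diff A (sym_diff B C)"
  by blast

instantiation clifford :: ("{finite,linorder}") "{one,times}"
begin

definition one_clifford :: "'a clifford" where
  "one_clifford = blade {}"

definition times_clifford :: "'a clifford \<Rightarrow> 'a clifford \<Rightarrow> 'a clifford" where
  "x * y = (\<Sum>A\<in>UNIV. \<Sum>B\<in>UNIV.
     (coords x $ A * coords y $ B * blade_sign A B) *\<^sub>R blade (sym_diff A B))"

instance ..

end

lemma blade_mult: "blade A * blade B = blade_sign A B *\<^sub>R blade (sym_diff A B)"
proof -
  have "blade A * blade B = (\<Sum>A'\<in>UNIV. \<Sum>B'\<in>UNIV. if A' = A then (if B' = B then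
      blade_sign A' B' *\<^sub>R blade (sym_diff A' B') else 0) else 0)"
    unfolding times_clifford_def coords_blade by (intro sum.cong refl) auto
  also have "\<dots> = (\<Sum>A'\<in>UNIV. if A' = A then (\<Sum>B'\<in>UNIV. if B' = B then
      blade_sign A' B' *\<^sub>R blade (sym_diff A' B') else 0) else 0)"
    by (intro sum.cong refl) auto
  finally show ?thesis by simp
qed

instance clifford :: ("{finite,linorder}") real_algebra_1
proof
  fix x y z :: "'a clifford" and r :: real
  have distl: "(u + v) * w = u * w + v * w" for u v w :: "'a clifford"
    by (simp add: times_clifford_def algebra_simps sum.distrib)
  have distr: "u * (v + w) = u * v + u * w" for u v w :: "'a clifford"
    by (simp add: times_clifford_def algebra_simps sum.distrib)
  have scl: "(c *\<^sub>R u) * v = c *\<^sub>R (u * v)" for c :: real and u v :: "'a clifford"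
    by (simp add: times_clifford_def scaleR_sum_right mult.assoc)
  have scr: "u * (c *\<^sub>R v) = c *\<^sub>R (u * v)" for c :: real and u v :: "'a clifford"
    by (simp add: times_clifford_def scaleR_sum_right algebra_simps)
  show "(x + y) * z = x * z + y * z" by (rule distl)
  show "x * (y + z) = x * y + x * z" by (rule distr)
  show "(r *\<^sub>R x) * y = r *\<^sub>R (x * y)" by (rule scl)
  show "x * (r *\<^sub>R y) = r *\<^sub>R (x * y)" by (rule scr)
  have ext: "P u = Q u" if "linear P" "linear Q" "\<And>A. P (blade A) = Q (blade A)"
    for P Q :: "'a clifford \<Rightarrow> 'a clifford" and u
  proof -
    have "P u = (\<Sum>A\<in>UNIV. (coords u $ A) *\<^sub>R P (blade A))"
      by (subst blade_expansion[of u]) (simp add: linear_sum[OF that(1)] linear_scale[OF that(1)])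
    also have "\<dots> = Q u"
      by (subst (2) blade_expansion[of u])
        (simp add: linear_sum[OF that(2)] linear_scale[OF that(2)] that(3))
    finally show ?thesis .
  qed
  have a1: "blade A * blade B * blade C = blade A * (blade B * blade C)" for A B C :: "'a set"
    by (simp add: blade_mult scl scr sym_diff_assoc blade_sign_sym_diff_left blade_sign_sym_diff_right
        mult_ac)
  have a2: "blade A * blade B * u = blade A * (blade B * u)" for A B :: "'a set" and u
    by (rule ext[of "\<lambda>u. blade A * blade B * u" "\<lambda>u. blade A * (blade B * u)"])
      (auto intro!: linearI simp: distl distr scl scr a1)
  have a3: "blade A * v * u = blade A * (v * u)" for A :: "'a set" and u v
    by (rule ext[of "\<lambda>v. blade A * v * u" "\<lambda>v. blade A * (v * u)"])
      (auto intro!: linearI simp: distl distr scl scr a2)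
  show "x * y * z = x * (y * z)"
    by (rule ext[of "\<lambda>x. x * y * z" "\<lambda>x. x * (y * z)"])
      (auto intro!: linearI simp: distl distr scl scr a3)
  show "1 * x = x"
    by (rule ext[of "\<lambda>x. 1 * x" "\<lambda>x. x"])
      (auto intro!: linearI simp: distl distr scl scr one_clifford_def blade_mult)
  show "x * 1 = x"
    by (rule ext[of "\<lambda>x. x * 1" "\<lambda>x. x"])
      (auto intro!: linearI simp: distl distr scl scr one_clifford_def blade_mult)
  show "(0::'a clifford) \<noteq> 1"
    by (auto simp: one_clifford_def clifford_eq_iff coords_blade)
qed

text \<open>
  The topology is the Euclidean one in the blade coordinates. This norm is not submultiplicative,
  which is why there is no instance of the class \<open>real_normed_algebra\<close>.
\<close>

instantiation clifford :: ("{finite,linorder}") real_inner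
begin

lift_definition inner_clifford :: "'a clifford \<Rightarrow> 'a clifford \<Rightarrow> real" is "(\<bullet>)" .
lift_definition norm_clifford :: "'a clifford \<Rightarrow> real" is norm .

definition dist_clifford :: "'a clifford \<Rightarrow> 'a clifford \<Rightarrow> real" where
  "dist_clifford x y = norm (x - y)"

definition sgn_clifford :: "'a clifford \<Rightarrow> 'a clifford" where
  "sgn_clifford x = x /\<^sub>R norm x"

definition uniformity_clifford :: "('a clifford \<times> 'a clifford) filter" where
  "uniformity_clifford = (INF e\<in>{0<..}. principal {(x, y). dist x y < e})"

definition open_clifford :: "'a clifford set \<Rightarrow> bool" where
  "open_clifford U \<longleftrightarrow> (\<forall>x\<in>U. \<forall>\<^sub>F (x', y) in uniformity. x' = x \<longrightarrow> y \<in> U)"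

instance
proof
  fix x y z :: "'a clifford" and r :: real
  show "x \<bullet> y = y \<bullet> x" by transfer (rule inner_commute)
  show "(x + y) \<bullet> z = x \<bullet> z + y \<bullet> z" by transfer (rule inner_add_left)
  show "(r *\<^sub>R x) \<bullet> y = r * (x \<bullet> y)" by transfer (rule inner_scaleR_left)
  show "0 \<le> x \<bullet> x" by transfer (rule inner_ge_zero)
  show "x \<bullet> x = 0 \<longleftrightarrow> x = 0" by transfer (rule inner_eq_zero_iff)
  show "norm x = sqrt (x \<bullet> x)" by transfer (rule norm_eq_sqrt_inner)
qed (simp_all add: dist_clifford_def sgn_clifford_def uniformity_clifford_def open_clifford_def)

end

instantiation clifford :: ("{finite,linorder}") euclidean_space
begin

definition Basis_clifford :: "'a clifford set" where
  "Basis_clifford = range blade"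

instance
proof
  have inn: "blade A \<bullet> blade B = (if A = B then 1 else 0)" for A B :: "'a set"
    by transfer (simp add: inner_axis_axis)
  show "(Basis :: 'a clifford set) \<noteq> {}" "finite (Basis :: 'a clifford set)"
    by (simp_all add: Basis_clifford_def)
  show "u \<bullet> v = (if u = v then 1 else 0)" if "u \<in> Basis" "v \<in> Basis" for u v :: "'a clifford"
    using that by (auto simp: Basis_clifford_def inn)
  have "u \<bullet> blade A = coords u $ A" for u :: "'a clifford" and A
    by transfer (simp add: inner_axis)
  then show "(\<forall>u\<in>Basis. x \<bullet> u = 0) \<longleftrightarrow> x = 0" for x :: "'a clifford"
    by (simp add: Basis_clifford_def clifford_eq_iff)
qed

end

definition gen :: "'n \<Rightarrow> 'n::{finite,linorder} clifford" where
  "gen i = blade {i}"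

lemma gen_relations: "gen i * gen j + gen j * gen i = (if i = j then -2 else 0)"
proof (cases "i = j")
  case True
  have "{(k, l). k = j \<and> l = j \<and> l \<le> k} = {(j, j)}" by auto
  then have "gen j * gen j = - 1"
    by (simp add: gen_def blade_mult blade_sign_def one_clifford_def)
  then show ?thesis using True by simp
next
  case False
  have *: "{(k, l). k = i \<and> l = j \<and> l \<le> k} = (if j \<le> i then {(i, j)} else {})" for i j :: 'a
    by auto
  have "sym_diff {i} {j} = {i, j}" "sym_diff {j} {i} = {i, j}" using False by auto
  then show ?thesis using False
    by (auto simp: gen_def blade_mult blade_sign_def * simp flip: scaleR_add_left)
qed

lemma blade_insert_less:
  assumes "\<And>j. j \<in> A \<Longrightarrow> i < j"
  shows "blade (insert i A) = gen i * blade A"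
proof -
  have "{(k, l). k \<in> {i} \<and> l \<in> A \<and> l \<le> k} = {}"
    using assms by fastforce
  then have "blade_sign {i} A = 1"
    unfolding blade_sign_def by (simp only: card.empty power_0)
  moreover have "sym_diff {i} A = insert i A"
    using assms by fastforce
  ultimately show ?thesis
    by (simp add: gen_def blade_mult)
qed

lemma DIM_clifford: "DIM('n::{finite,linorder} clifford) = 2 ^ CARD('n)"
proof -
  have "inj (blade :: 'n set \<Rightarrow> 'n clifford)"
    by (rule injI) (metis coords_blade zero_neq_one)
  moreover have "card (UNIV :: 'n set set) = 2 ^ CARD('n)"
    by (metis Pow_UNIV card_Pow finite)
  ultimately show ?thesis
    by (simp add: Basis_clifford_def card_image)
qed


section \<open>Vectors and paravectors\<close>

text \<open>
  A point of \<open>\<real>\<^sup>n\<^sup>+\<^sup>1\<close> is a pair \<open>(x\<^sub>0, v)\<close> in \<open>real \<times> (real ^ 'n)\<close>, with the Euclidean product norm.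
\<close>

type_synonym 'n rvec = "real ^ 'n"
type_synonym 'n pvec = "real \<times> (real ^ 'n)"

definition cvec :: "'n rvec \<Rightarrow> 'n::{finite,linorder} clifford" where
  "cvec v = (\<Sum>i\<in>UNIV. (v $ i) *\<^sub>R gen i)"

definition paravec :: "'n pvec \<Rightarrow> 'n::{finite,linorder} clifford" where
  "paravec x = of_real (fst x) + cvec (snd x)"


section \<open>Differentiability notions\<close>

definition C1_on :: "'a set \<Rightarrow> ('a::real_normed_vector \<Rightarrow> 'b::real_normed_vector) \<Rightarrow> bool" where
  "C1_on S f \<longleftrightarrow> (\<exists>f' :: 'a \<Rightarrow> 'a \<Rightarrow>\<^sub>L 'b.
     (\<forall>x\<in>S. (f has_derivative blinfun_apply (f' x)) (at x)) \<and> continuous_on S f')"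

definition C1_diffeo :: "'a::real_normed_vector set \<Rightarrow> 'b::real_normed_vector set
    \<Rightarrow> ('a \<Rightarrow> 'b) \<Rightarrow> bool" where
  "C1_diffeo U V a \<longleftrightarrow> bij_betw a U V \<and> C1_on U a \<and> C1_on V (inv_into U a)"

definition pderivative ::
    "('a::real_normed_vector \<Rightarrow> 'b::real_normed_vector) \<Rightarrow> 'a \<Rightarrow> 'a \<Rightarrow> 'b" where
  "pderivative f e x = vector_derivative (\<lambda>h. f (x + h *\<^sub>R e)) (at 0)"

text \<open>
  Applied to \<open>a\<close>, the lift is the paravector-valued map \<open>x\<^sub>0 + a(v)\<close>; applied to the inverse
  \<open>inv_into U a\<close> of a bijection \<open>a\<close> from \<open>U\<close> to \<open>V\<close>, it is the inverse of that map.
\<close>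

definition lift_para :: "('n rvec \<Rightarrow> 'n rvec) \<Rightarrow> 'n pvec \<Rightarrow> 'n pvec" where
  "lift_para a x = (fst x, a (snd x))"

definition H_op :: "'n rvec set \<Rightarrow> ('n rvec \<Rightarrow> 'n rvec)
    \<Rightarrow> ('n pvec \<Rightarrow> 'n::{finite,linorder} clifford) \<Rightarrow> 'n pvec \<Rightarrow> 'n clifford" where
  "H_op U a f x =
     cvec (a (snd x)) * pderivative f (1, 0) x
     - (\<Sum>i\<in>UNIV. (\<Sum>j\<in>UNIV. a (snd x) $ j
            * pderivative (\<lambda>y. inv_into U a y $ i) (axis j 1) (a (snd x)))
          *\<^sub>R pderivative f (0, axis i 1) x)"

text \<open>
  For \<open>I\<close> in the unit sphere, \<open>u + I v\<close> is the point \<open>(u, v *\<^sub>R I)\<close>. The set \<open>W\<close> is meant to be open,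
  so that the partial derivatives of the restriction to a slice only involve values of \<open>h\<close> on \<open>W\<close>.
\<close>

definition slice_monogenic :: "'n pvec set
    \<Rightarrow> ('n pvec \<Rightarrow> 'n::{finite,linorder} clifford) set" where
  "slice_monogenic W = {h. h differentiable_on W \<and>
     (\<forall>I \<in> sphere 0 1. \<forall>u v. (u, v *\<^sub>R I) \<in> W \<longrightarrow>
        vector_derivative (\<lambda>u'. h (u', v *\<^sub>R I)) (at u)
        + cvec I * vector_derivative (\<lambda>v'. h (u, v' *\<^sub>R I)) (at v) = 0)}"

end

theory Submission
  imports Defs "HOL-Complex_Analysis.Conformal_Mappings"
begin

text \<open>
  Put \<open>g = f \<circ> a\<^sup>-\<^sup>1\<close>. Multiplying the Cauchy-Riemann equation of \<open>g\<close> at \<open>(u, v I)\<close> from the left by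
  \<open>v I\<close> gives \<open>y \<partial>\<^sub>0 g = D g (0, y)\<close> with \<open>y = v I\<close>, and by the chain rule this is \<open>H\<^sub>a f = 0\<close>.

  For the expansion, let \<open>l\<close> be a real coordinate functional on the Clifford algebra. Then
  \<open>L x = l x - i l (I x)\<close> is complex linear when \<open>i\<close> acts as left multiplication by \<open>I\<close>, so
  \<open>u + i v \<mapsto> L (g (u + I v))\<close> is an ordinary holomorphic function on the unit disc.
  Its Taylor expansion for one fixed \<open>I\<close> expands \<open>g\<close> on the real axis, which yields the
  coefficients; since all slices share the real axis, the identity theorem carries the expansion
  over to every other \<open>I\<close>, and \<open>l = Re \<circ> L\<close> recovers the coordinates of \<open>g\<close>.
\<close>

section \<open>The slice planes of the Clifford algebra\<close>

lemma cvec_scaleR: "cvec (r *\<^sub>R v) = r *\<^sub>R cvec v"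
  by (simp add: cvec_def scaleR_sum_right)

text \<open>Doubling the product and swapping the summation indices in one copy produces the
  anticommutators of the generators, of which only the diagonal ones survive.\<close>

lemma cvec_square: "cvec v * cvec v = - of_real (v \<bullet> v)"
proof -
  have "2 *\<^sub>R (cvec v * cvec v)
      = (\<Sum>i\<in>UNIV. \<Sum>j\<in>UNIV. (v $ i * v $ j) *\<^sub>R (gen i * gen j))
        + (\<Sum>i\<in>UNIV. \<Sum>j\<in>UNIV. (v $ i * v $ j) *\<^sub>R (gen i * gen j))"
    by (simp add: cvec_def sum_product scaleR_2 mult.commute)
  also have "\<dots> = (\<Sum>i\<in>UNIV. \<Sum>j\<in>UNIV. (v $ i * v $ j) *\<^sub>R (gen i * gen j))
        + (\<Sum>i\<in>UNIV. \<Sum>j\<in>UNIV. (v $ i * v $ j) *\<^sub>R (gen j * gen i))"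
    by (subst (2) sum.swap) (simp add: mult.commute)
  also have "\<dots> = (\<Sum>i\<in>UNIV. \<Sum>j\<in>UNIV. (v $ i * v $ j) *\<^sub>R (gen i * gen j + gen j * gen i))"
    by (simp add: sum.distrib scaleR_add_right)
  also have "\<dots> = (\<Sum>i\<in>UNIV. \<Sum>j\<in>UNIV. if i = j then (v $ i * v $ i) *\<^sub>R (- 2) else 0)"
    by (intro sum.cong refl) (simp add: gen_relations)
  also have "\<dots> = (\<Sum>i\<in>UNIV. of_real ((v $ i * v $ i) * (- 2)))"
    by (simp add: scaleR_conv_of_real)
  also have "\<dots> = of_real ((v \<bullet> v) * (- 2))"
    by (simp only: inner_vec_def inner_real_def sum_distrib_right of_real_sum)
  also have "\<dots> = 2 *\<^sub>R (- of_real (v \<bullet> v))"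
    by (simp add: of_real_def)
  finally show ?thesis
    by (subst (asm) scaleR_cancel_left) simp
qed

lemma cvec_square_unit:
  assumes "norm I = 1"
  shows "cvec I * cvec I = - 1" "cvec I * (cvec I * x) = - x"
proof -
  show *: "cvec I * cvec I = - 1"
    using assms by (simp add: cvec_square dot_square_norm)
  show "cvec I * (cvec I * x) = - x"
    by (simp add: * flip: mult.assoc)
qed

section \<open>Continuity and convergence in blade coordinates\<close>

lemma bounded_linear_clifford_mult_left:
  "bounded_linear (\<lambda>x :: 'n::{finite,linorder} clifford. c * x)"
  by (intro linear_conv_bounded_linear[THEN iffD1] linearI) (simp_all add: distrib_left)

lemma bounded_linear_coord:
  "bounded_linear (\<lambda>x :: 'n::{finite,linorder} clifford. coords x $ A)"
  by (intro linear_conv_bounded_linear[THEN iffD1] linearI) simp_all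

lemma clifford_sums_iff:
  fixes h :: "nat \<Rightarrow> 'n::{finite,linorder} clifford"
  shows "h sums x \<longleftrightarrow> (\<forall>A. (\<lambda>k. coords (h k) $ A) sums (coords x $ A))"
proof
  assume "h sums x"
  then show "\<forall>A. (\<lambda>k. coords (h k) $ A) sums (coords x $ A)"
    by (blast intro: bounded_linear.sums[OF bounded_linear_coord])
next
  assume "\<forall>A. (\<lambda>k. coords (h k) $ A) sums (coords x $ A)"
  then have "(\<lambda>k. \<Sum>A\<in>UNIV. (coords (h k) $ A) *\<^sub>R blade A) sums (\<Sum>A\<in>UNIV. (coords x $ A) *\<^sub>R blade A)"
    by (intro sums_sum sums_scaleR_left) blast
  then show "h sums x"
    by (simp flip: blade_expansion)
qed

section \<open>Complex linear functionals adapted to a slice plane\<close>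

definition slice_functional ::
    "'n rvec \<Rightarrow> 'n set \<Rightarrow> 'n::{finite,linorder} clifford \<Rightarrow> complex" where
  "slice_functional I A x = of_real (coords x $ A) - \<i> * of_real (coords (cvec I * x) $ A)"

lemma Re_slice_functional [simp]: "Re (slice_functional I A x) = coords x $ A"
  by (simp add: slice_functional_def)

lemma bounded_linear_slice_functional: "bounded_linear (slice_functional I A)"
  unfolding slice_functional_def
  by (intro bounded_linear_sub bounded_linear_const_mult
      bounded_linear_compose[OF bounded_linear_of_real]
      bounded_linear_compose[OF bounded_linear_coord bounded_linear_clifford_mult_left]
      bounded_linear_coord)

lemmas slice_functional_linear =
  linear_add[OF bounded_linear.linear[OF bounded_linear_slice_functional]]
  linear_scale[OF bounded_linear.linear[OF bounded_linear_slice_functional]]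

text \<open>Replacing \<open>x\<close> by \<open>I x\<close> exchanges the two coordinates in the
  definition up to a sign, since \<open>I (I x) = - x\<close>; this is multiplication by
  \<open>\<i>\<close>.\<close>

lemma slice_functional_cvec_mult:
  assumes "norm I = 1"
  shows "slice_functional I A (cvec I * x) = \<i> * slice_functional I A x"
  by (simp add: slice_functional_def cvec_square_unit[OF assms] complex_eq_iff)

lemma slice_functional_paravec_mult:
  assumes "norm I = 1"
  shows "slice_functional I A (paravec (Re z, Im z *\<^sub>R I) * x) = z * slice_functional I A x"
proof -
  have "paravec (Re z, Im z *\<^sub>R I) * x = Re z *\<^sub>R x + Im z *\<^sub>R (cvec I * x)"
    by (simp add: paravec_def cvec_scaleR distrib_right of_real_def)
  then show ?thesis
    by (simp add: slice_functional_linear slice_functional_cvec_mult[OF assms] complex_eq_iff)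
qed

text \<open>Turns Clifford power series into complex ones. The coefficient stands on the right, so
  the powers act by left multiplication and no commutation with it is needed.\<close>

lemma slice_functional_paravec_power:
  assumes "norm I = 1"
  shows "slice_functional I A (paravec (Re z, Im z *\<^sub>R I) ^ k * x) = z ^ k * slice_functional I A x"
  by (induction k) (simp_all add: slice_functional_paravec_mult[OF assms] mult.assoc)

section \<open>Slice monogenic functions\<close>

lemma slice_monogenic_cauchy_riemann:
  assumes "g \<in> slice_monogenic W" "norm I = 1" "(u, v *\<^sub>R I) \<in> W"
    and D: "(g has_derivative D) (at (u, v *\<^sub>R I))"
  shows "D (0, I) = cvec I * D (1, 0)"
proof -
  have lin: "linear D"
    using D has_derivative_linear by blast
  have "((\<lambda>u'. g (u', v *\<^sub>R I)) has_derivative (\<lambda>h. D (h, 0))) (at u)"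
    by (rule has_derivative_compose[where f = "\<lambda>u'. (u', v *\<^sub>R I)", OF _ D])
      (auto intro!: derivative_eq_intros)
  also have "(\<lambda>h. D (h, 0)) = (\<lambda>h. h *\<^sub>R D (1, 0))"
    by (simp flip: linear_scale[OF lin])
  finally have 1: "vector_derivative (\<lambda>u'. g (u', v *\<^sub>R I)) (at u) = D (1, 0)"
    by (intro vector_derivative_at) (simp only: has_vector_derivative_def)
  have "((\<lambda>v'. g (u, v' *\<^sub>R I)) has_derivative (\<lambda>h. D (0, h *\<^sub>R I))) (at v)"
    by (rule has_derivative_compose[where f = "\<lambda>v'. (u, v' *\<^sub>R I)", OF _ D])
      (auto intro!: derivative_eq_intros)
  also have "(\<lambda>h. D (0, h *\<^sub>R I)) = (\<lambda>h. h *\<^sub>R D (0, I))"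
    by (simp flip: linear_scale[OF lin])
  finally have 2: "vector_derivative (\<lambda>v'. g (u, v' *\<^sub>R I)) (at v) = D (0, I)"
    by (intro vector_derivative_at) (simp only: has_vector_derivative_def)
  have "D (1, 0) + cvec I * D (0, I) = 0"
    using assms(1-3) unfolding slice_monogenic_def 1[symmetric] 2[symmetric] mem_Collect_eq
    by (metis mem_sphere_0)
  \<comment> \<open>Left multiplication by \<open>I\<close> turns \<open>I * I\<close> into
    \<open>- 1\<close> and so isolates \<open>D (0, I)\<close>.\<close>
  then have "cvec I * (D (1, 0) + cvec I * D (0, I)) = 0"
    by simp
  then show ?thesis
    by (simp add: distrib_left cvec_square_unit[OF assms(2)])
qed

lemma vector_in_slice:
  fixes w :: "'n::finite rvec"
  obtains I r where "norm I = 1" "w = r *\<^sub>R I"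
proof (cases "w = 0")
  case True
  obtain I :: "'n rvec" where "norm I = 1"
    using vector_choose_size[of 1] by auto
  then show ?thesis
    using True that[of I 0] by simp
next
  case False
  then show ?thesis
    using that[of "w /\<^sub>R norm w" "norm w"] by simp
qed

text \<open>Scaling the Cauchy-Riemann equation by \<open>r\<close>, where \<open>w = r I\<close>,
  removes the choice of \<open>I\<close> and covers real points as well, where both sides
  vanish.\<close>

lemma slice_monogenic_radial:
  assumes "g \<in> slice_monogenic W" "(u, w) \<in> W"
    and D: "(g has_derivative D) (at (u, w))"
  shows "cvec w * D (1, 0) = D (0, w)"
proof -
  obtain I r where I: "norm I = 1" "w = r *\<^sub>R I"
    by (rule vector_in_slice)
  have "D (0, w) = r *\<^sub>R D (0, I)"
    by (simp add: I(2) flip: linear_scale[OF has_derivative_linear[OF D]])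
  also have "D (0, I) = cvec I * D (1, 0)"
    by (rule slice_monogenic_cauchy_riemann[OF assms(1) I(1) assms(2-3)[unfolded I(2)]])
  finally show ?thesis
    by (simp add: I(2) cvec_scaleR)
qed

section \<open>Power series expansion on the unit ball\<close>

lemma holomorphic_slice_functional:
  assumes g: "g \<in> slice_monogenic W" and "open W" "ball 0 1 \<subseteq> W" and I: "norm I = 1"
  shows "(\<lambda>z. slice_functional I A (g (Re z, Im z *\<^sub>R I))) holomorphic_on ball 0 1"
proof (rule holomorphic_onI)
  fix z :: complex
  assume "z \<in> ball 0 1"
  then have "(Re z, Im z *\<^sub>R I) \<in> ball 0 1"
    using I by (simp add: norm_Pair cmod_def)
  then have W: "(Re z, Im z *\<^sub>R I) \<in> W"
    using assms(3) by blast
  have "g differentiable_on W"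
    using g unfolding slice_monogenic_def by blast
  then obtain D where D: "(g has_derivative D) (at (Re z, Im z *\<^sub>R I))"
    using W \<open>open W\<close> unfolding differentiable_on_eq_differentiable_at[OF \<open>open W\<close>] differentiable_def
    by blast
  have "((\<lambda>z. g (Re z, Im z *\<^sub>R I)) has_derivative (\<lambda>h. D (Re h, Im h *\<^sub>R I))) (at z)"
    by (rule has_derivative_compose[where f = "\<lambda>z. (Re z, Im z *\<^sub>R I)", OF _ D])
      (auto intro!: derivative_eq_intros)
  then have "((\<lambda>z. slice_functional I A (g (Re z, Im z *\<^sub>R I))) has_derivative
      (\<lambda>h. slice_functional I A (D (Re h, Im h *\<^sub>R I)))) (at z)"
    by (rule bounded_linear.has_derivative[OF bounded_linear_slice_functional])
  \<comment> \<open>By the Cauchy-Riemann equation the real derivative along the slice becomes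
    complex linear, that is, multiplication by one complex number.\<close>
  moreover have "slice_functional I A (D (Re h, Im h *\<^sub>R I)) = slice_functional I A (D (1, 0)) * h" for h
  proof -
    have "D (Re h, Im h *\<^sub>R I) = D (Re h *\<^sub>R (1, 0) + Im h *\<^sub>R (0, I))"
      by simp
    also have "\<dots> = Re h *\<^sub>R D (1, 0) + Im h *\<^sub>R D (0, I)"
      unfolding linear_add[OF has_derivative_linear[OF D]] linear_scale[OF has_derivative_linear[OF D]] ..
    also have "\<dots> = Re h *\<^sub>R D (1, 0) + Im h *\<^sub>R (cvec I * D (1, 0))"
      unfolding slice_monogenic_cauchy_riemann[OF g I W D] ..
    finally show ?thesis
      by (simp add: slice_functional_linear slice_functional_cvec_mult[OF I] complex_eq_iff)
  qed
  ultimately have "((\<lambda>z. slice_functional I A (g (Re z, Im z *\<^sub>R I))) has_field_derivative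
      slice_functional I A (D (1, 0))) (at z)"
    by (simp add: has_field_derivative_def)
  then show "(\<lambda>z. slice_functional I A (g (Re z, Im z *\<^sub>R I))) field_differentiable at z within ball 0 1"
    using field_differentiable_at_within field_differentiable_def by blast
qed

text \<open>One arbitrary slice suffices. Powers of a real \<open>u\<close> pass through
  \<open>Re\<close>, so the real parts of the Taylor coefficients at 0 serve as the coordinates of
  \<open>c k\<close>.\<close>

lemma slice_monogenic_real_axis_expansion:
  fixes g :: "'n::{finite,linorder} pvec \<Rightarrow> 'n clifford"
  assumes "g \<in> slice_monogenic W" "open W" "ball 0 1 \<subseteq> W"
  obtains c where "\<And>u. \<bar>u\<bar> < 1 \<Longrightarrow> (\<lambda>k. u ^ k *\<^sub>R c k) sums g (u, 0)"
proof -
  obtain I :: "'n rvec" where I: "norm I = 1"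
    using vector_choose_size[of 1] by auto
  define F where "F A z = slice_functional I A (g (Re z, Im z *\<^sub>R I))" for A z
  define p where "p A k = (deriv ^^ k) (F A) 0 / fact k" for A k
  define c where "c k = (\<Sum>A\<in>UNIV. Re (p A k) *\<^sub>R blade A)" for k
  have coords_c: "coords (c k) $ A = Re (p A k)" for k A
    by (simp add: c_def coords_blade if_distrib cong: if_cong)
  have "(\<lambda>k. u ^ k *\<^sub>R c k) sums g (u, 0)" if "\<bar>u\<bar> < 1" for u
    unfolding clifford_sums_iff
  proof
    fix A
    have "F A holomorphic_on ball 0 1"
      unfolding F_def by (rule holomorphic_slice_functional[OF assms I])
    then have "(\<lambda>k. p A k * (of_real u - 0) ^ k) sums F A (of_real u)"
      unfolding p_def by (rule holomorphic_power_series) (use that in simp)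
    from sums_Re[OF this] have "(\<lambda>k. Re (p A k * of_real u ^ k)) sums Re (F A (of_real u))"
      by simp
    moreover have "Re (p A k * of_real u ^ k) = u ^ k * Re (p A k)" for k
      by (simp flip: of_real_power)
    ultimately show "(\<lambda>k. coords (u ^ k *\<^sub>R c k) $ A) sums (coords (g (u, 0)) $ A)"
      by (simp add: coords_c F_def mult.commute)
  qed
  then show ?thesis
    by (rule that)
qed

text \<open>Convergence at real points near 1 forces convergence in the whole disc. The difference
  of \<open>F\<close> and the series then vanishes on a real interval accumulating at 0, hence
  everywhere by the identity theorem.\<close>

lemma holomorphic_eq_powser_on_reals:
  fixes F :: "complex \<Rightarrow> complex"
  assumes F: "F holomorphic_on ball 0 1"
    and real: "\<And>u. \<bar>u\<bar> < 1 \<Longrightarrow> (\<lambda>k. b k * of_real u ^ k) sums F (of_real u)"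
    and z: "z \<in> ball 0 1"
  shows "(\<lambda>k. b k * z ^ k) sums F z"
proof -
  have sums: "(\<lambda>k. b k * (w - 0) ^ k) sums (\<Sum>k. b k * w ^ k)" if "w \<in> ball 0 1" for w
  proof -
    obtain r where r: "norm w < r" "r < 1"
      using \<open>w \<in> ball 0 1\<close> dense by auto
    then have "\<bar>r\<bar> < 1"
      using norm_ge_zero[of w] by linarith
    then have "summable (\<lambda>k. b k * of_real r ^ k)"
      using real sums_summable by blast
    then have "summable (\<lambda>k. b k * w ^ k)"
      by (rule powser_inside) (use r norm_ge_zero[of w] in simp)
    then show ?thesis
      by (simp add: summable_sums)
  qed
  then have hol: "(\<lambda>w. \<Sum>k. b k * w ^ k) holomorphic_on ball 0 1"
    by (rule power_series_holomorphic)
  have "F z - (\<Sum>k. b k * z ^ k) = 0"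
  proof (rule analytic_continuation[where f = "\<lambda>w. F w - (\<Sum>k. b k * w ^ k)"
        and S = "ball 0 1" and U = "of_real ` {-1<..<1}" and \<xi> = 0])
    show "(\<lambda>w. F w - (\<Sum>k. b k * w ^ k)) holomorphic_on ball 0 1"
      by (intro holomorphic_intros F hol)
    show "of_real ` {-1<..<1} \<subseteq> ball (0::complex) 1"
      by auto
    show "(0::complex) islimpt of_real ` {-1<..<1}"
      unfolding islimpt_approachable
    proof (intro allI impI)
      fix e :: real
      assume "e > 0"
      \<comment> \<open>Half of \<open>e\<close>, capped at 1/2 to stay in the interval, gives the
        nonzero point close to 0.\<close>
      then have "min (e / 2) (1 / 2) \<in> {-1<..<1}" "0 < min (e / 2) (1 / 2)" "min (e / 2) (1 / 2) < e"
        by auto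
      then show "\<exists>x'\<in>of_real ` {-1<..<1}. x' \<noteq> (0::complex) \<and> dist x' 0 < e"
        by (intro bexI[of _ "of_real (min (e / 2) (1 / 2))"]) (auto simp del: min_less_iff_conj)
    qed
    show "F w - (\<Sum>k. b k * w ^ k) = 0" if "w \<in> of_real ` {-1<..<1}" for w
      using that real by (auto simp: sums_iff abs_less_iff)
  qed (use z in auto)
  then show ?thesis
    using sums[OF z] by simp
qed

theorem slice_monogenic_ball_expansion:
  fixes g :: "'n::{finite,linorder} pvec \<Rightarrow> 'n clifford"
  assumes "g \<in> slice_monogenic W" "open W" "ball 0 1 \<subseteq> W"
  obtains c where "\<And>y. y \<in> ball 0 1 \<Longrightarrow> (\<lambda>k. paravec y ^ k * c k) sums g y"
proof -
  obtain c where c: "\<And>u. \<bar>u\<bar> < 1 \<Longrightarrow> (\<lambda>k. u ^ k *\<^sub>R c k) sums g (u, 0)"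
    using slice_monogenic_real_axis_expansion[OF assms] by blast
  have "(\<lambda>k. paravec y ^ k * c k) sums g y" if y: "y \<in> ball 0 1" for y
  proof -
    \<comment> \<open>The slice is chosen to contain \<open>y\<close>; the coefficients
      \<open>c\<close> were fixed before and do not depend on it.\<close>
    obtain I r where I: "norm I = 1" "snd y = r *\<^sub>R I"
      by (rule vector_in_slice)
    define z where "z = Complex (fst y) r"
    have y_eq: "y = (Re z, Im z *\<^sub>R I)"
      by (simp add: z_def prod_eq_iff I)
    have z: "z \<in> ball 0 1"
      using y I by (simp add: y_eq norm_Pair cmod_def)
    show ?thesis
      unfolding clifford_sums_iff
    proof
      fix A
      have "(\<lambda>k. slice_functional I A (c k) * z ^ k) sums slice_functional I A (g (Re z, Im z *\<^sub>R I))"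
      proof (rule holomorphic_eq_powser_on_reals[OF _ _ z])
        fix u :: real
        assume "\<bar>u\<bar> < 1"
        \<comment> \<open>Every slice contains the real point \<open>(u, 0)\<close>, so the
          expansion on the real axis applies to this \<open>I\<close> too.\<close>
        then have "(\<lambda>k. slice_functional I A (u ^ k *\<^sub>R c k)) sums slice_functional I A (g (u, 0))"
          by (intro bounded_linear.sums[OF bounded_linear_slice_functional] c)
        then show "(\<lambda>k. slice_functional I A (c k) * of_real u ^ k) sums
            slice_functional I A (g (Re (of_real u), Im (of_real u) *\<^sub>R I))"
          by (simp only: slice_functional_linear Re_complex_of_real Im_complex_of_real scaleR_zero_left)
            (simp add: scaleR_conv_of_real mult.commute)
      qed (rule holomorphic_slice_functional[OF assms I(1)])
      then have "(\<lambda>k. slice_functional I A (paravec y ^ k * c k)) sums slice_functional I A (g y)"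
        by (simp add: y_eq slice_functional_paravec_power[OF I(1)] mult.commute)
      from sums_Re[OF this] show "(\<lambda>k. coords (paravec y ^ k * c k) $ A) sums (coords (g y) $ A)"
        by simp
    qed
  qed
  then show ?thesis
    by (rule that)
qed

section \<open>The operator \<open>H\<^sub>a\<close>\<close>

lemma pderivative_eq:
  assumes D: "(f has_derivative D) (at x)"
  shows "pderivative f e x = D e"
proof -
  have "((\<lambda>h. f (x + h *\<^sub>R e)) has_derivative (\<lambda>h. D (h *\<^sub>R e))) (at 0)"
    by (rule has_derivative_compose[where f = "\<lambda>h. x + h *\<^sub>R e"])
      (use D in \<open>auto intro!: derivative_eq_intros\<close>)
  then show ?thesis
    unfolding pderivative_def
    by (intro vector_derivative_at)
      (simp add: has_vector_derivative_def linear_scale[OF has_derivative_linear[OF D]])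
qed

lemma linear_axis_expansion:
  fixes L :: "real ^ 'n \<Rightarrow> 'b::real_vector"
  assumes "linear L"
  shows "L w = (\<Sum>j\<in>UNIV. (w $ j) *\<^sub>R L (axis j 1))"
  by (subst (1) basis_expansion[of w, symmetric])
    (simp add: scalar_mult_eq_scaleR linear_sum[OF assms] linear_scale[OF assms])

text \<open>The double sum is the derivative \<open>B\<close> of the inverse map applied to the
  vector \<open>a (snd x)\<close> itself, so the second term of the operator is a single directional
  derivative of \<open>f\<close>.\<close>

lemma H_op_eq:
  fixes f :: "'n::{finite,linorder} pvec \<Rightarrow> 'n clifford"
  assumes D: "(f has_derivative D) (at x)"
    and B: "(inv_into U a has_derivative B) (at (a (snd x)))"
  shows "H_op U a f x = cvec (a (snd x)) * D (1, 0) - D (0, B (a (snd x)))"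
proof -
  have comp: "pderivative (\<lambda>y. inv_into U a y $ i) (axis j 1) (a (snd x)) = B (axis j 1) $ i" for i j
    by (rule pderivative_eq) (rule bounded_linear.has_derivative[OF bounded_linear_vec_nth B])
  have "B (a (snd x)) $ i = (\<Sum>j\<in>UNIV. a (snd x) $ j * B (axis j 1) $ i)" for i
    by (subst linear_axis_expansion[OF has_derivative_linear[OF B]]) simp
  moreover have "linear (\<lambda>w. D (0, w))"
    using linear_compose[OF _ has_derivative_linear[OF D], of "\<lambda>w. (0, w)"]
    by (simp add: o_def linear_iff)
  then have "D (0, B (a (snd x))) = (\<Sum>i\<in>UNIV. (B (a (snd x)) $ i) *\<^sub>R D (0, axis i 1))"
    by (rule linear_axis_expansion)
  ultimately show ?thesis
    by (simp add: H_op_def comp pderivative_eq[OF D])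
qed

text \<open>By the chain rule \<open>f \<circ> lift_para (inv_into U a)\<close> has derivative
  \<open>D (fst h, B (snd h))\<close> at the image of \<open>x\<close>; the radial identity there is
  exactly the vanishing of the operator.\<close>

lemma H_op_eq_0:
  fixes f :: "'n::{finite,linorder} pvec \<Rightarrow> 'n clifford"
  assumes a: "bij_betw a U V" and x: "x \<in> T \<times> U"
    and D: "(f has_derivative D) (at x)"
    and B: "(inv_into U a has_derivative B) (at (a (snd x)))"
    and mono: "f \<circ> lift_para (inv_into U a) \<in> slice_monogenic (T \<times> V)"
  shows "H_op U a f x = 0"
proof -
  obtain u v where xuv: "x = (u, v)" "u \<in> T" "v \<in> U"
    using x by auto
  have inv: "inv_into U a (a v) = v"
    using a xuv by (simp add: bij_betw_inv_into_left)
  have "((\<lambda>y. f (fst y, inv_into U a (snd y))) has_derivative (\<lambda>h. D (fst h, B (snd h)))) (at (u, a v))"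
  proof (rule has_derivative_compose[where f = "\<lambda>y. (fst y, inv_into U a (snd y))"])
    have "((\<lambda>y. inv_into U a (snd y)) has_derivative (\<lambda>h. B (snd h))) (at (u, a v))"
      by (rule has_derivative_compose[where f = snd]) (use B xuv in \<open>auto intro!: derivative_eq_intros\<close>)
    then show "((\<lambda>y. (fst y, inv_into U a (snd y))) has_derivative (\<lambda>h. (fst h, B (snd h)))) (at (u, a v))"
      by (auto intro!: derivative_eq_intros)
    show "(f has_derivative D) (at (fst (u, a v), inv_into U a (snd (u, a v))))"
      using D xuv inv by simp
  qed
  then have "(f \<circ> lift_para (inv_into U a) has_derivative (\<lambda>h. D (fst h, B (snd h)))) (at (u, a v))"
    by (simp add: lift_para_def o_def)
  moreover have "(u, a v) \<in> T \<times> V"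
    using a xuv by (auto simp: bij_betw_def)
  \<comment> \<open>The term \<open>B 0\<close> is the vector part of the image of the direction
    \<open>(1, 0)\<close>; it is 0 by linearity.\<close>
  ultimately have "cvec (a v) * D (1, B 0) = D (0, B (a v))"
    using slice_monogenic_radial[OF mono] by fastforce
  then show ?thesis
    using H_op_eq[OF D B] linear_0[OF has_derivative_linear[OF B]] by (simp add: xuv)
qed

text \<open>Endpoints in \<open>ereal\<close> admit unbounded intervals.\<close>

theorem proposition3p8:
  fixes s t :: ereal
    and U V :: "'n::{finite,linorder} rvec set"
    and a :: "'n rvec \<Rightarrow> 'n rvec"
    and f :: "'n pvec \<Rightarrow> 'n clifford"
  assumes "s < t"
    and "open U" "connected U" "U \<noteq> {}"
    and "open V" "connected V" "V \<noteq> {}"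
    and "C1_diffeo U V a"
    and "C1_on (einterval s t \<times> U) f"
    and "f \<circ> lift_para (inv_into U a) \<in> slice_monogenic (einterval s t \<times> V)"
    and "ball 0 1 \<subseteq> einterval s t \<times> V"
  shows "(\<forall>x \<in> einterval s t \<times> U. H_op U a f x = 0) \<and>
    (\<exists>c :: nat \<Rightarrow> 'n clifford.
      \<forall>x \<in> (einterval s t \<times> U) \<inter> lift_para a -` ball 0 1.
        (\<lambda>k. paravec (lift_para a x) ^ k * c k) sums f x)"
proof
  have bij: "bij_betw a U V" and inv: "C1_on V (inv_into U a)"
    using \<open>C1_diffeo U V a\<close> by (auto simp: C1_diffeo_def)
  show "\<forall>x \<in> einterval s t \<times> U. H_op U a f x = 0"
  proof
    fix x
    assume x: "x \<in> einterval s t \<times> U"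
    then obtain D where D: "(f has_derivative D) (at x)"
      using \<open>C1_on (einterval s t \<times> U) f\<close> unfolding C1_on_def by blast
    have "a (snd x) \<in> V"
      using x bij by (auto simp: bij_betw_def)
    then obtain B where B: "(inv_into U a has_derivative B) (at (a (snd x)))"
      using inv unfolding C1_on_def by blast
    show "H_op U a f x = 0"
      by (rule H_op_eq_0[OF bij x D B assms(10)])
  qed
  have "open (einterval s t \<times> V)"
    using \<open>open V\<close> by (intro open_Times) auto
  then obtain c where c: "\<And>y. y \<in> ball 0 1 \<Longrightarrow>
      (\<lambda>k. paravec y ^ k * c k) sums (f \<circ> lift_para (inv_into U a)) y"
    using slice_monogenic_ball_expansion[OF assms(10) _ assms(11)] by blast
  have "(\<lambda>k. paravec (lift_para a x) ^ k * c k) sums f x"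
    if "x \<in> (einterval s t \<times> U) \<inter> lift_para a -` ball 0 1" for x
  proof -
    \<comment> \<open>\<open>inv_into U a\<close> undoes \<open>a\<close> on \<open>U\<close>, which
      is why the preimage of the ball is intersected with the domain.\<close>
    have "lift_para (inv_into U a) (lift_para a x) = x"
      using that bij by (auto simp: lift_para_def bij_betw_inv_into_left)
    then show ?thesis
      using c[of "lift_para a x"] that by simp
  qed
  then show "\<exists>c :: nat \<Rightarrow> 'n clifford. \<forall>x \<in> (einterval s t \<times> U) \<inter> lift_para a -` ball 0 1.
      (\<lambda>k. paravec (lift_para a x) ^ k * c k) sums f x"
    by blast
qed

end
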